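(* Let $h\ge 1$ and let $a_1,\dots,a_h$ be non-zero integers, and let $\mathscr{L}$ denote the linear form $a_1x_1+\cdots+a_hx_h$. (i) There exists a unique representation $\mathscr{L}$-basis (that is, a set $A\subseteq\mathbb{Z}$ with $f_{A,\mathscr{L}}(n)=1$ for every $n\in\mathbb{Z}$) if and only if $\mathscr{L}$ is primitive, i.e. $\gcd(a_1,\dots,a_h)=1$. (ii) The following are equivalent: (a) $\mathscr{L}$ is primitive and not all of the $a_i$ have the same sign; (b) for every $n\in\mathbb{Z}$ there exists a unique representation $\mathscr{L}$-basis $A(n)$ with $A(n)\subseteq[n,+\infty)$.
   Context: For $A\subseteq\mathbb{Z}$ and $n\in\mathbb{Z}$, a representation of $n$ by $\mathscr{L}$ (in $A$) is an $h$-tuple $(x_1,\dots,x_h)\in A^h$ with $a_1x_1+\cdots+a_hx_h=n$. Two representations $(x_1,\dots,x_h)$ and $(y_1,\dots,y_h)$ of the same integer $n$ are called equivalent if for every $\xi\in\mathbb{Z}$, $\sum_{i:\,x_i=\xi}a_i=\sum_{i:\,y_i=\xi}a_i$. The (unordered) representation function $f_{A,\mathscr{L}}(n)\in\mathbb{N}_0\cup\{\infty\}$ is the number of equivalence classes of representations of $n$ by $\mathscr{L}$ in $A$. *)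

theory Defs
  imports Complex_Main "HOL-Library.FuncSet" "HOL-Library.Extended_Nat"
begin

text \<open>A linear form in \<open>h\<close> variables is given by its coefficients \<open>a i\<close>, \<open>i \<in> {1..h}\<close>; the values
  of \<open>a\<close> at other indices are irrelevant. An \<open>h\<close>-tuple over \<open>A\<close> is an extensional function in
  \<open>{1..h} \<rightarrow>\<^sub>E A\<close>, so that distinct functions are distinct tuples.\<close>

definition representations :: "nat \<Rightarrow> (nat \<Rightarrow> int) \<Rightarrow> int set \<Rightarrow> int \<Rightarrow> (nat \<Rightarrow> int) set" where
  "representations h a A n = {x \<in> {1..h} \<rightarrow>\<^sub>E A. (\<Sum>i=1..h. a i * x i) = n}"

definition equiv_representations :: "nat \<Rightarrow> (nat \<Rightarrow> int) \<Rightarrow> (nat \<Rightarrow> int) \<Rightarrow> (nat \<Rightarrow> int) \<Rightarrow> bool" where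
  "equiv_representations h a x y \<longleftrightarrow>
     (\<forall>\<xi>::int. (\<Sum>i | i \<in> {1..h} \<and> x i = \<xi>. a i) = (\<Sum>i | i \<in> {1..h} \<and> y i = \<xi>. a i))"

definition representation_rel ::
    "nat \<Rightarrow> (nat \<Rightarrow> int) \<Rightarrow> int set \<Rightarrow> int \<Rightarrow> ((nat \<Rightarrow> int) \<times> (nat \<Rightarrow> int)) set" where
  "representation_rel h a A n =
     {(x, y). x \<in> representations h a A n \<and> y \<in> representations h a A n \<and>
              equiv_representations h a x y}"

lemma equiv_representation_rel:
  "equiv (representations h a A n) (representation_rel h a A n)"
  by (rule equivI)
     (auto simp: refl_on_def sym_def trans_def representation_rel_def equiv_representations_def)

definition representation_function :: "nat \<Rightarrow> (nat \<Rightarrow> int) \<Rightarrow> int set \<Rightarrow> int \<Rightarrow> enat" where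
  "representation_function h a A n =
     (let Q = representations h a A n // representation_rel h a A n
      in if finite Q then enat (card Q) else \<infinity>)"

definition unique_representation_basis :: "nat \<Rightarrow> (nat \<Rightarrow> int) \<Rightarrow> int set \<Rightarrow> bool" where
  "unique_representation_basis h a A \<longleftrightarrow> (\<forall>n. representation_function h a A n = 1)"

definition primitive_form :: "nat \<Rightarrow> (nat \<Rightarrow> int) \<Rightarrow> bool" where
  "primitive_form h a \<longleftrightarrow> Gcd (a ` {1..h}) = 1"

end

theory Submission
  imports Defs "HOL-Library.Nat_Bijection"
begin

text \<open>
  The basis is built greedily. Starting from a singleton, keep a finite nonempty set \<open>A\<close> on which
  inequivalent tuples have different values; while some \<open>n\<close> is not represented, adjoin the entries of
  a generic integer solution \<open>x\<close> of \<open>a\<^sub>1 x\<^sub>1 + \<dots> + a\<^sub>h x\<^sub>h = n\<close>. By genericity, a coincidence between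
  two tuples over the enlarged set is a formal identity up to adding \<open>c\<close> times this equation, for
  some integer \<open>c\<close>, without loss of generality \<open>c \<ge> 0\<close>. If \<open>c = 0\<close>, sending all new elements to
  one element of \<open>A\<close> reduces the coincidence to one inside \<open>A\<close>. If \<open>c = 1\<close>, view the first tuple as
  a map \<open>P\<close> from indices to indices (new elements) or elements of \<open>A\<close>; a retraction \<open>\<phi>\<close> onto \<open>A\<close>
  that is constant along the orbits of \<open>P\<close> turns the second tuple into a representation of \<open>n\<close> in
  \<open>A\<close>. If \<open>c \<ge> 2\<close>, the new elements alone use up the total absolute weight of the two tuples, whence
  \<open>n = 0 = a\<^sub>1 + \<dots> + a\<^sub>h\<close>, and constant tuples over \<open>A\<close> represent \<open>n\<close>. When the coefficients have
  both signs, \<open>x\<close> can be shifted by a large multiple of a positive kernel vector, so all new elements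
  may be taken large.
\<close>

section \<open>Generic solutions of a linear equation\<close>

lemma bezout_Gcd:
  fixes a :: "'i \<Rightarrow> int"
  assumes "finite I"
  shows "\<exists>u. (\<Sum>i\<in>I. a i * u i) = Gcd (a ` I)"
  using assms
proof (induction I)
  case (insert j I)
  then obtain u where u: "(\<Sum>i\<in>I. a i * u i) = Gcd (a ` I)" by blast
  obtain p q where pq: "p * a j + q * Gcd (a ` I) = gcd (a j) (Gcd (a ` I))"
    using bezout_int by blast
  have "(\<Sum>i\<in>insert j I. a i * (if i = j then p else q * u i)) = p * a j + (\<Sum>i\<in>I. q * (a i * u i))"
    using insert.hyps by (auto simp: mult_ac intro!: sum.cong)
  also have "\<dots> = Gcd (a ` insert j I)"
    using u pq by (simp add: sum_distrib_left[symmetric])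
  finally show ?case by (rule exI[of _ "\<lambda>i. if i = j then p else q * u i"])
qed simp

lemma exists_positive_kernel_vector:
  fixes a :: "'i \<Rightarrow> int"
  assumes "finite I" "p \<in> I" "a p > 0" "q \<in> I" "a q < 0"
  shows "\<exists>k. (\<Sum>i\<in>I. a i * k i) = 0 \<and> (\<forall>i\<in>I. k i \<ge> 1)"
proof -
  define P where "P = (\<Sum>i\<in>I. max (a i) 0)"
  define Q where "Q = (\<Sum>i\<in>I. max (- a i) 0)"
  define k where "k i = (if a i > 0 then Q else P)" for i
  have "P \<ge> a p"
    unfolding P_def using member_le_sum[of p I "\<lambda>i. max (a i) 0"] assms(1,2) by simp
  moreover have "Q \<ge> - a q"
    unfolding Q_def using member_le_sum[of q I "\<lambda>i. max (- a i) 0"] assms(1,4) by simp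
  ultimately have "\<forall>i\<in>I. k i \<ge> 1" using assms by (simp add: k_def)
  moreover have "(\<Sum>i\<in>I. a i * k i) = 0"
  proof -
    have "(\<Sum>i\<in>I. a i * k i) = (\<Sum>i\<in>I. Q * max (a i) 0 - P * max (- a i) 0)"
      by (rule sum.cong) (auto simp: k_def)
    also have "\<dots> = Q * P - P * Q"
      unfolding sum_subtractf sum_distrib_left[symmetric] P_def[symmetric] Q_def[symmetric] ..
    finally show ?thesis by simp
  qed
  ultimately show ?thesis by blast
qed

definition generic_solution :: "'i set \<Rightarrow> ('i \<Rightarrow> int) \<Rightarrow> int \<Rightarrow> int \<Rightarrow> ('i \<Rightarrow> int) \<Rightarrow> bool" where
  "generic_solution I a n K x \<longleftrightarrow> (\<Sum>i\<in>I. a i * x i) = n \<and>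
     (\<forall>d e. (\<forall>i\<in>I. \<bar>d i\<bar> \<le> K) \<longrightarrow> \<bar>e\<bar> \<le> K \<longrightarrow> (\<Sum>i\<in>I. d i * x i) + e = 0 \<longrightarrow>
       (\<exists>c. (\<forall>i\<in>I. d i = c * a i) \<and> e = - c * n))"

lemma generic_solutionI:
  assumes "(\<Sum>i\<in>I. a i * x i) = n"
    and "\<And>d e. \<lbrakk>\<forall>i\<in>I. \<bar>d i\<bar> \<le> K; \<bar>e\<bar> \<le> K; (\<Sum>i\<in>I. d i * x i) + e = 0\<rbrakk>
      \<Longrightarrow> \<exists>c. (\<forall>i\<in>I. d i = c * a i) \<and> e = - c * n"
  shows "generic_solution I a n K x"
  using assms unfolding generic_solution_def by blast

lemma generic_solution_sum: "generic_solution I a n K x \<Longrightarrow> (\<Sum>i\<in>I. a i * x i) = n"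
  unfolding generic_solution_def by blast

lemma generic_solutionD:
  assumes "generic_solution I a n K x"
    and "\<forall>i\<in>I. \<bar>d i\<bar> \<le> K" "\<bar>e\<bar> \<le> K" "(\<Sum>i\<in>I. d i * x i) + e = 0"
  shows "\<exists>c. (\<forall>i\<in>I. d i = c * a i) \<and> e = - c * n"
  using assms unfolding generic_solution_def by blast

lemma abs_sum_mult_le:
  fixes d x :: "'i \<Rightarrow> 'c::linordered_idom"
  assumes "\<forall>i\<in>I. \<bar>d i\<bar> \<le> K"
  shows "\<bar>\<Sum>i\<in>I. d i * x i\<bar> \<le> K * (\<Sum>i\<in>I. \<bar>x i\<bar>)"
proof -
  have "\<bar>\<Sum>i\<in>I. d i * x i\<bar> \<le> (\<Sum>i\<in>I. \<bar>d i * x i\<bar>)" by (rule sum_abs)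
  also have "\<dots> \<le> (\<Sum>i\<in>I. K * \<bar>x i\<bar>)"
    using assms by (intro sum_mono) (auto simp: abs_mult intro: mult_right_mono)
  finally show ?thesis by (simp add: sum_distrib_left)
qed

lemma abs_affine_le:
  fixes d x :: "'i \<Rightarrow> 'c::linordered_idom"
  assumes "\<forall>i\<in>I. \<bar>d i\<bar> \<le> K" "\<bar>e\<bar> \<le> K"
  shows "\<bar>(\<Sum>i\<in>I. d i * x i) + e\<bar> \<le> K * ((\<Sum>i\<in>I. \<bar>x i\<bar>) + 1)"
  using abs_sum_mult_le[OF assms(1), of x] assms(2) by (simp add: distrib_left)

lemma dominant_term_eq_0:
  fixes d x :: "'i \<Rightarrow> int"
  assumes d: "\<forall>i\<in>I. \<bar>d i\<bar> \<le> K" and e: "\<bar>e\<bar> \<le> K" and T: "K * ((\<Sum>i\<in>I. \<bar>x i\<bar>) + 1) < T"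
    and eq: "m * T + ((\<Sum>i\<in>I. d i * x i) + e) = 0"
  shows "m = 0 \<and> (\<Sum>i\<in>I. d i * x i) + e = 0"
proof -
  define r where "r = (\<Sum>i\<in>I. d i * x i) + e"
  have small: "\<bar>r\<bar> < T"
    unfolding r_def using abs_affine_le[OF d e] T by (rule order.strict_trans1)
  have mult: "m * T + r = 0" using eq unfolding r_def .
  then have "r = T * (- m)" by (simp add: mult.commute)
  then have "T dvd r" by (rule dvdI)
  then have "r = 0" using small dvd_imp_le_int[of r T] by (cases "r = 0") auto
  with mult small show ?thesis unfolding r_def[symmetric] by simp
qed

lemma generic_solution_add_multiple:
  assumes x: "generic_solution I a n K x" and k: "(\<Sum>i\<in>I. a i * k i) = 0"
    and T: "K * ((\<Sum>i\<in>I. \<bar>x i\<bar>) + 1) < T"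
  shows "generic_solution I a n K (\<lambda>i. x i + T * k i)"
proof -
  have affine: "(\<Sum>i\<in>I. d i * (x i + T * k i)) = (\<Sum>i\<in>I. d i * k i) * T + (\<Sum>i\<in>I. d i * x i)" for d
    by (simp add: distrib_left sum.distrib sum_distrib_left mult_ac)
  show ?thesis
  proof (rule generic_solutionI)
    show "(\<Sum>i\<in>I. a i * (x i + T * k i)) = n"
      unfolding affine k generic_solution_sum[OF x] by simp
  next
    fix d e
    assume d: "\<forall>i\<in>I. \<bar>d i\<bar> \<le> K" and e: "\<bar>e\<bar> \<le> K"
      and eq: "(\<Sum>i\<in>I. d i * (x i + T * k i)) + e = 0"
    have "(\<Sum>i\<in>I. d i * k i) * T + ((\<Sum>i\<in>I. d i * x i) + e) = 0"
      using eq unfolding affine add.assoc .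
    then have "(\<Sum>i\<in>I. d i * x i) + e = 0"
      using dominant_term_eq_0[OF d e T] by blast
    with d e show "\<exists>c. (\<forall>i\<in>I. d i = c * a i) \<and> e = - c * n"
      by (rule generic_solutionD[OF x])
  qed
qed

text \<open>A generic solution of \<open>0 = 0\<close> satisfies no nontrivial relation of small height.\<close>

lemma exists_generic_solution_zero:
  assumes "finite I"
  shows "\<exists>t. generic_solution I (\<lambda>_. 0) 0 K t"
  using assms
proof (induction I)
  case empty
  then show ?case by (simp add: generic_solution_def)
next
  case (insert j I)
  then obtain t where t: "generic_solution I (\<lambda>_. 0) 0 K t" by blast
  define T where "T = K * ((\<Sum>i\<in>I. \<bar>t i\<bar>) + 1) + 1"
  have "generic_solution (insert j I) (\<lambda>_. 0) 0 K (t(j := T))"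
  proof (rule generic_solutionI)
    fix d e
    assume d: "\<forall>i\<in>insert j I. \<bar>d i\<bar> \<le> K" and e: "\<bar>e\<bar> \<le> K"
      and eq: "(\<Sum>i\<in>insert j I. d i * (t(j := T)) i) + e = 0"
    have "(\<Sum>i\<in>I. d i * (t(j := T)) i) = (\<Sum>i\<in>I. d i * t i)"
      using insert.hyps by (intro sum.cong) auto
    then have "d j * T + ((\<Sum>i\<in>I. d i * t i) + e) = 0"
      using eq insert.hyps by simp
    moreover have "\<forall>i\<in>I. \<bar>d i\<bar> \<le> K" "K * ((\<Sum>i\<in>I. \<bar>t i\<bar>) + 1) < T"
      using d by (simp_all add: T_def)
    ultimately have "d j = 0 \<and> (\<Sum>i\<in>I. d i * t i) + e = 0"
      using dominant_term_eq_0 e by blast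
    then show "\<exists>c. (\<forall>i\<in>insert j I. d i = c * 0) \<and> e = - c * 0"
      using generic_solutionD[OF t, of d e] d e by simp
  qed simp
  then show ?case by blast
qed

lemma abs_add_sum_mult_le:
  fixes d u :: "'i \<Rightarrow> 'c::linordered_idom"
  assumes "\<forall>i\<in>I. \<bar>d i\<bar> \<le> K" "\<bar>r\<bar> \<le> K" "\<bar>m\<bar> \<le> M"
  shows "\<bar>r + (\<Sum>i\<in>I. d i * u i) * m\<bar> \<le> K * (1 + (\<Sum>i\<in>I. \<bar>u i\<bar>) * M)"
proof -
  let ?D = "\<Sum>i\<in>I. d i * u i" and ?U = "\<Sum>i\<in>I. \<bar>u i\<bar>"
  have D: "\<bar>?D\<bar> \<le> K * ?U" by (rule abs_sum_mult_le[OF assms(1)])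
  then have "0 \<le> K * ?U" by (rule order_trans[OF abs_ge_zero])
  then have "\<bar>?D * m\<bar> \<le> K * ?U * M"
    unfolding abs_mult by (intro mult_mono D assms(3) abs_ge_zero)
  then have "\<bar>r\<bar> + \<bar>?D * m\<bar> \<le> K + K * ?U * M"
    by (rule add_mono[OF assms(2)])
  then show ?thesis
    using abs_triangle_ineq[of r "?D * m"] by (simp add: distrib_left mult.assoc)
qed

text \<open>Writing \<open>x\<close> for the new solution and \<open>c = d \<bullet> u\<close>, the relation \<open>d \<bullet> x + e = 0\<close> becomes
  \<open>(d - c a) \<bullet> t + (e + c n) = 0\<close>.\<close>

lemma generic_solution_bezout:
  assumes "finite I" and u: "(\<Sum>i\<in>I. a i * u i) = 1"
    and t: "generic_solution I (\<lambda>_. 0) 0 (K * (1 + (\<Sum>i\<in>I. \<bar>u i\<bar>) * ((\<Sum>i\<in>I. \<bar>a i\<bar>) + \<bar>n\<bar>))) t"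
  shows "generic_solution I a n K (\<lambda>i. t i + (n - (\<Sum>j\<in>I. a j * t j)) * u i)"
    (is "generic_solution I a n K ?x")
proof (rule generic_solutionI)
  let ?M = "(\<Sum>i\<in>I. \<bar>a i\<bar>) + \<bar>n\<bar>" and ?s = "\<Sum>i\<in>I. a i * t i"
  have dot_x: "(\<Sum>i\<in>I. d i * ?x i) = (\<Sum>i\<in>I. d i * t i) + (n - ?s) * (\<Sum>i\<in>I. d i * u i)" for d
    by (simp add: distrib_left sum.distrib sum_distrib_right mult_ac)
  show "(\<Sum>i\<in>I. a i * ?x i) = n"
    unfolding dot_x u by simp
  fix d e
  assume d: "\<forall>i\<in>I. \<bar>d i\<bar> \<le> K" and e: "\<bar>e\<bar> \<le> K" and eq: "(\<Sum>i\<in>I. d i * ?x i) + e = 0"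
  define c where "c = (\<Sum>i\<in>I. d i * u i)"
  have bound: "\<bar>r + c * m\<bar> \<le> K * (1 + (\<Sum>i\<in>I. \<bar>u i\<bar>) * ?M)" if "\<bar>r\<bar> \<le> K" "\<bar>m\<bar> \<le> ?M" for r m
    unfolding c_def using d that by (rule abs_add_sum_mult_le)
  have "\<forall>i\<in>I. \<bar>d i - c * a i\<bar> \<le> K * (1 + (\<Sum>i\<in>I. \<bar>u i\<bar>) * ?M)"
  proof
    fix i assume i: "i \<in> I"
    then have "\<bar>d i\<bar> \<le> K" using d by blast
    moreover have "\<bar>- a i\<bar> \<le> ?M"
      using member_le_sum[OF i, of "\<lambda>i. \<bar>a i\<bar>"] \<open>finite I\<close> by simp
    ultimately have "\<bar>d i + c * - a i\<bar> \<le> K * (1 + (\<Sum>i\<in>I. \<bar>u i\<bar>) * ?M)"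
      by (rule bound)
    then show "\<bar>d i - c * a i\<bar> \<le> K * (1 + (\<Sum>i\<in>I. \<bar>u i\<bar>) * ?M)"
      by simp
  qed
  moreover have "\<bar>e + c * n\<bar> \<le> K * (1 + (\<Sum>i\<in>I. \<bar>u i\<bar>) * ?M)"
    using bound[OF e, of n] by (simp add: sum_nonneg)
  moreover have "(\<Sum>i\<in>I. (d i - c * a i) * t i) + (e + c * n) = 0"
    using eq unfolding dot_x c_def[symmetric]
    by (simp add: left_diff_distrib sum_subtractf sum_distrib_left algebra_simps)
  ultimately have "\<exists>c'. (\<forall>i\<in>I. d i - c * a i = c' * 0) \<and> e + c * n = - c' * 0"
    by (rule generic_solutionD[OF t])
  then show "\<exists>c. (\<forall>i\<in>I. d i = c * a i) \<and> e = - c * n"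
    by (intro exI[of _ c]) auto
qed

lemma exists_generic_solution:
  assumes "finite I" "(\<Sum>i\<in>I. a i * u i) = 1"
  shows "\<exists>x. generic_solution I a n K x"
  using generic_solution_bezout[OF assms] exists_generic_solution_zero[OF assms(1)] by blast

lemma exists_generic_solution_ge:
  assumes "finite I" "(\<Sum>i\<in>I. a i * u i) = 1"
    and k: "(\<Sum>i\<in>I. a i * k i) = 0" "\<forall>i\<in>I. k i \<ge> 1"
  shows "\<exists>x \<in> I \<rightarrow> {N..}. generic_solution I a n K x"
proof -
  obtain x where x: "generic_solution I a n K x"
    using exists_generic_solution[OF assms(1,2)] by blast
  define S where "S = (\<Sum>i\<in>I. \<bar>x i\<bar>)"
  define T where "T = \<bar>K * (S + 1)\<bar> + 1 + S + \<bar>N\<bar>"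
  have "S \<ge> 0" by (simp add: S_def sum_nonneg)
  have "K * ((\<Sum>i\<in>I. \<bar>x i\<bar>) + 1) < T"
    unfolding S_def[symmetric] T_def using \<open>S \<ge> 0\<close> by linarith
  with x k(1) have "generic_solution I a n K (\<lambda>i. x i + T * k i)"
    by (rule generic_solution_add_multiple)
  moreover have "x i + T * k i \<ge> N" if "i \<in> I" for i
  proof -
    have "x i \<ge> - S"
      using member_le_sum[OF that, of "\<lambda>i. \<bar>x i\<bar>"] \<open>finite I\<close> by (simp add: S_def)
    moreover have "T * k i \<ge> T * 1"
      using k(2) that \<open>S \<ge> 0\<close> by (intro mult_left_mono) (auto simp: T_def)
    moreover have "T \<ge> S + N" by (simp add: T_def)
    ultimately show ?thesis by linarith
  qed
  ultimately show ?thesis by (intro bexI[of _ "\<lambda>i. x i + T * k i"]) auto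
qed

section \<open>Weights of tuples\<close>

definition weight :: "'i set \<Rightarrow> ('i \<Rightarrow> 'c::comm_monoid_add) \<Rightarrow> ('i \<Rightarrow> 'b) \<Rightarrow> 'b \<Rightarrow> 'c" where
  "weight I a x s = (\<Sum>i | i \<in> I \<and> x i = s. a i)"

lemma weight_restrict [simp]: "weight I a (restrict x I) = weight I a x"
  by (rule ext) (auto simp: weight_def intro!: sum.cong)

lemma weight_cong: "(\<And>i. i \<in> I \<Longrightarrow> x i = y i) \<Longrightarrow> weight I a x = weight I a y"
  by (rule ext) (auto simp: weight_def intro!: sum.cong)

lemma weight_eq_0: "x \<in> I \<rightarrow> S \<Longrightarrow> s \<notin> S \<Longrightarrow> weight I a x s = 0"
  unfolding weight_def by (rule sum.neutral) auto

lemma sum_weight: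
  fixes a :: "'i \<Rightarrow> 'c::semiring_0"
  assumes "finite I" "finite S" "x \<in> I \<rightarrow> S"
  shows "(\<Sum>s\<in>S. weight I a x s * g s) = (\<Sum>i\<in>I. a i * g (x i))"
proof -
  have "(\<Sum>s\<in>S. weight I a x s * g s) = (\<Sum>s\<in>S. \<Sum>i | i \<in> I \<and> x i = s. a i * g (x i))"
    unfolding weight_def sum_distrib_right by (intro sum.cong) auto
  also have "\<dots> = (\<Sum>i\<in>I. a i * g (x i))"
    using assms by (intro sum.group) auto
  finally show ?thesis .
qed

lemma weight_comp:
  fixes a :: "'i \<Rightarrow> 'c::semiring_1"
  assumes "finite I" "finite S" "x \<in> I \<rightarrow> S"
  shows "weight I a (f \<circ> x) t = (\<Sum>s\<in>S. weight I a x s * of_bool (f s = t))"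
proof -
  have "weight I a (f \<circ> x) t = (\<Sum>i\<in>I. a i * of_bool (f (x i) = t))"
    unfolding weight_def using assms(1) by (intro sum.mono_neutral_cong_left) auto
  then show ?thesis
    using sum_weight[OF assms, of a "\<lambda>s. of_bool (f s = t)"] by simp
qed

lemma weight_comp_eq:
  fixes a :: "'i \<Rightarrow> 'c::semiring_1"
  assumes "finite I" and "weight I a x = weight I a y"
  shows "weight I a (f \<circ> x) = weight I a (f \<circ> y)"
proof
  fix t
  have "x \<in> I \<rightarrow> x ` I \<union> y ` I" "y \<in> I \<rightarrow> x ` I \<union> y ` I" "finite (x ` I \<union> y ` I)"
    using assms(1) by auto
  then show "weight I a (f \<circ> x) t = weight I a (f \<circ> y) t"
    using assms by (simp only: weight_comp)
qed

lemma sum_abs_weight_le: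
  fixes a :: "'i \<Rightarrow> 'c::ordered_ab_group_add_abs"
  assumes "finite I" "finite S" "x \<in> I \<rightarrow> S"
  shows "(\<Sum>s\<in>S. \<bar>weight I a x s\<bar>) \<le> (\<Sum>i\<in>I. \<bar>a i\<bar>)"
proof -
  have "(\<Sum>s\<in>S. \<bar>weight I a x s\<bar>) \<le> (\<Sum>s\<in>S. \<Sum>i | i \<in> I \<and> x i = s. \<bar>a i\<bar>)"
    unfolding weight_def by (intro sum_mono sum_abs)
  also have "\<dots> = (\<Sum>i\<in>I. \<bar>a i\<bar>)"
    using assms by (intro sum.group) auto
  finally show ?thesis .
qed

definition weight_diff ::
    "'i set \<Rightarrow> ('i \<Rightarrow> 'c::ab_group_add) \<Rightarrow> ('i \<Rightarrow> 'b) \<Rightarrow> ('i \<Rightarrow> 'b) \<Rightarrow> 'b \<Rightarrow> 'c" where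
  "weight_diff I a x y s = weight I a x s - weight I a y s"

lemma weight_diff_swap: "weight_diff I a y x s = - weight_diff I a x y s"
  by (simp add: weight_diff_def)

lemma sum_weight_diff:
  fixes a :: "'i \<Rightarrow> 'c::ring"
  assumes "finite I" "finite S" "x \<in> I \<rightarrow> S" "y \<in> I \<rightarrow> S"
  shows "(\<Sum>s\<in>S. weight_diff I a x y s * g s) =
    (\<Sum>i\<in>I. a i * g (x i)) - (\<Sum>i\<in>I. a i * g (y i))"
  using assms by (simp add: weight_diff_def left_diff_distrib sum_subtractf sum_weight)

lemma sum_abs_weight_diff_le:
  fixes a :: "'i \<Rightarrow> 'c::linordered_idom"
  assumes "finite I" "finite S" "x \<in> I \<rightarrow> S" "y \<in> I \<rightarrow> S"
  shows "(\<Sum>s\<in>S. \<bar>weight_diff I a x y s\<bar>) \<le> 2 * (\<Sum>i\<in>I. \<bar>a i\<bar>)"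
proof -
  have "(\<Sum>s\<in>S. \<bar>weight_diff I a x y s\<bar>) \<le> (\<Sum>s\<in>S. \<bar>weight I a x s\<bar> + \<bar>weight I a y s\<bar>)"
    unfolding weight_diff_def by (intro sum_mono abs_triangle_ineq4)
  also have "\<dots> \<le> 2 * (\<Sum>i\<in>I. \<bar>a i\<bar>)"
    using sum_abs_weight_le[OF assms(1-3), of a] sum_abs_weight_le[OF assms(1,2,4), of a]
    by (simp add: sum.distrib)
  finally show ?thesis .
qed

lemma weight_diff_comp:
  fixes a :: "'i \<Rightarrow> 'c::ring_1"
  assumes "finite I" "finite S" "x \<in> I \<rightarrow> S" "y \<in> I \<rightarrow> S"
  shows "weight_diff I a (f \<circ> x) (f \<circ> y) t = (\<Sum>s\<in>S. weight_diff I a x y s * of_bool (f s = t))"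
  unfolding weight_diff_def weight_comp[OF assms(1-3)] weight_comp[OF assms(1,2,4)]
    left_diff_distrib sum_subtractf ..

lemma weight_diff_eq_0_imp_weight_eq:
  assumes "x \<in> I \<rightarrow> S" "y \<in> I \<rightarrow> S" and "\<And>s. s \<in> S \<Longrightarrow> weight_diff I a x y s = 0"
  shows "weight I a x = weight I a y"
proof
  fix s show "weight I a x s = weight I a y s"
    using assms by (cases "s \<in> S") (auto simp: weight_diff_def weight_eq_0)
qed

section \<open>Values and uniqueness of representations\<close>

definition value_set :: "'i set \<Rightarrow> ('i \<Rightarrow> 'c::semiring_0) \<Rightarrow> 'c set \<Rightarrow> 'c set" where
  "value_set I a A = {\<Sum>i\<in>I. a i * x i | x. x \<in> I \<rightarrow> A}"

lemma value_setI: "x \<in> I \<rightarrow> A \<Longrightarrow> (\<Sum>i\<in>I. a i * x i) = n \<Longrightarrow> n \<in> value_set I a A"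
  unfolding value_set_def by blast

lemma value_setE:
  assumes "n \<in> value_set I a A"
  obtains x where "x \<in> I \<rightarrow> A" "(\<Sum>i\<in>I. a i * x i) = n"
  using assms unfolding value_set_def by blast

lemma value_set_mono: "A \<subseteq> B \<Longrightarrow> value_set I a A \<subseteq> value_set I a B"
  unfolding value_set_def by blast

lemma exists_pos_coeff_if_pos_value:
  fixes a :: "'i \<Rightarrow> 'c::linordered_idom"
  assumes "n \<in> value_set I a A" "A \<subseteq> {0..}" "n > 0"
  shows "\<exists>p\<in>I. a p > 0"
proof (rule ccontr)
  assume "\<not> (\<exists>p\<in>I. a p > 0)"
  then have nonpos: "\<forall>i\<in>I. a i \<le> 0" by force
  obtain x where x: "x \<in> I \<rightarrow> A" "(\<Sum>i\<in>I. a i * x i) = n"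
    using assms(1) by (rule value_setE)
  have "(\<Sum>i\<in>I. a i * x i) \<le> 0"
    using x(1) assms(2) nonpos by (intro sum_nonpos mult_nonpos_nonneg) auto
  with x(2) assms(3) show False by simp
qed

lemma exists_neg_coeff_if_neg_value:
  fixes a :: "'i \<Rightarrow> 'c::linordered_idom"
  assumes "n \<in> value_set I a A" "A \<subseteq> {0..}" "n < 0"
  shows "\<exists>q\<in>I. a q < 0"
proof -
  obtain x where "x \<in> I \<rightarrow> A" "(\<Sum>i\<in>I. a i * x i) = n"
    using assms(1) by (rule value_setE)
  then have "- n \<in> value_set I (\<lambda>i. - a i) A"
    by (intro value_setI[of x]) (auto simp: sum_negf)
  then have "\<exists>q\<in>I. - a q > 0"
    by (rule exists_pos_coeff_if_pos_value) (use assms in auto)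
  then show ?thesis by simp
qed

text \<open>For \<open>a = (\<lambda>_. 1)\<close> these are the \<open>B\<^sub>h\<close>-sets, where \<open>h = card I\<close>.\<close>

definition sidon_set :: "'i set \<Rightarrow> ('i \<Rightarrow> 'c::semiring_0) \<Rightarrow> 'c set \<Rightarrow> bool" where
  "sidon_set I a A \<longleftrightarrow> (\<forall>x \<in> I \<rightarrow> A. \<forall>y \<in> I \<rightarrow> A.
     (\<Sum>i\<in>I. a i * x i) = (\<Sum>i\<in>I. a i * y i) \<longrightarrow> weight I a x = weight I a y)"

lemma sidon_setI:
  assumes "\<And>x y. \<lbrakk>x \<in> I \<rightarrow> A; y \<in> I \<rightarrow> A; (\<Sum>i\<in>I. a i * x i) = (\<Sum>i\<in>I. a i * y i)\<rbrakk>
    \<Longrightarrow> weight I a x = weight I a y"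
  shows "sidon_set I a A"
  using assms unfolding sidon_set_def by blast

lemma sidon_setD:
  assumes "sidon_set I a A" "x \<in> I \<rightarrow> A" "y \<in> I \<rightarrow> A"
    and "(\<Sum>i\<in>I. a i * x i) = (\<Sum>i\<in>I. a i * y i)"
  shows "weight I a x = weight I a y"
  using assms unfolding sidon_set_def by blast

lemma sidon_set_singleton: "sidon_set I a {b}"
  by (intro sidon_setI weight_cong) auto

lemma sidon_set_Union_chain:
  assumes "finite I" and chain: "subset.chain UNIV \<C>" "\<C> \<noteq> {}"
    and sidon: "\<And>A. A \<in> \<C> \<Longrightarrow> sidon_set I a A"
  shows "sidon_set I a (\<Union>\<C>)"
proof (rule sidon_setI)
  fix x y
  assume xy: "x \<in> I \<rightarrow> \<Union>\<C>" "y \<in> I \<rightarrow> \<Union>\<C>" and eq: "(\<Sum>i\<in>I. a i * x i) = (\<Sum>i\<in>I. a i * y i)"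
  have "finite (x ` I \<union> y ` I)" "x ` I \<union> y ` I \<subseteq> \<Union>\<C>"
    using \<open>finite I\<close> xy by auto
  then obtain A where "A \<in> \<C>" "x ` I \<union> y ` I \<subseteq> A"
    using chain by (metis finite_subset_Union_chain)
  then show "weight I a x = weight I a y"
    using eq by (intro sidon_setD[OF sidon]) auto
qed

lemma sidon_set_image:
  fixes a :: "'i \<Rightarrow> 'c::semiring_1"
  assumes "finite I"
    and weight_eq: "\<And>P Q. \<lbrakk>P \<in> I \<rightarrow> S; Q \<in> I \<rightarrow> S;
      (\<Sum>i\<in>I. a i * f (P i)) = (\<Sum>i\<in>I. a i * f (Q i))\<rbrakk> \<Longrightarrow> weight I a P = weight I a Q"
  shows "sidon_set I a (f ` S)"
proof (rule sidon_setI)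
  fix x y
  assume x: "x \<in> I \<rightarrow> f ` S" and y: "y \<in> I \<rightarrow> f ` S"
    and eq: "(\<Sum>i\<in>I. a i * x i) = (\<Sum>i\<in>I. a i * y i)"
  let ?r = "inv_into S f"
  have r: "?r \<circ> z \<in> I \<rightarrow> S" "\<And>i. i \<in> I \<Longrightarrow> f (?r (z i)) = z i" if "z \<in> I \<rightarrow> f ` S" for z
    using that by (auto simp: Pi_iff inv_into_into f_inv_into_f)
  have "(\<Sum>i\<in>I. a i * f ((?r \<circ> x) i)) = (\<Sum>i\<in>I. a i * f ((?r \<circ> y) i))"
    using eq r(2)[OF x] r(2)[OF y] by simp
  then have "weight I a (?r \<circ> x) = weight I a (?r \<circ> y)"
    using weight_eq r(1)[OF x] r(1)[OF y] by blast
  then have "weight I a (f \<circ> (?r \<circ> x)) = weight I a (f \<circ> (?r \<circ> y))"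
    by (rule weight_comp_eq[OF \<open>finite I\<close>])
  moreover have "weight I a (f \<circ> (?r \<circ> z)) = weight I a z" if "z \<in> I \<rightarrow> f ` S" for z
    using r(2)[OF that] by (intro weight_cong) simp
  ultimately show "weight I a x = weight I a y"
    using x y by simp
qed

lemma card_quotient_eq_1_iff:
  assumes "equiv R r"
  shows "card (R // r) = 1 \<longleftrightarrow> R \<noteq> {} \<and> R \<times> R \<subseteq> r"
proof
  assume "card (R // r) = 1"
  then obtain C where C: "R // r = {C}"
    by (auto simp: card_1_singleton_iff)
  have "(x, y) \<in> r" if "x \<in> R" "y \<in> R" for x y
    using quotientI[OF that(1), of r] quotientI[OF that(2), of r] eq_equiv_class[OF _ assms that(2)]
    unfolding C by blast
  moreover have "R \<noteq> {}" using C by auto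
  ultimately show "R \<noteq> {} \<and> R \<times> R \<subseteq> r" by blast
next
  assume R: "R \<noteq> {} \<and> R \<times> R \<subseteq> r"
  moreover have "r \<subseteq> R \<times> R"
    using assms by (rule equivE)
  ultimately have "r `` {x} = R" if "x \<in> R" for x
    using that by blast
  then have "R // r = {R}"
    using R by (auto simp: quotient_def)
  then show "card (R // r) = 1" by simp
qed

lemma equiv_representations_iff_weight_eq:
  "equiv_representations h a x y \<longleftrightarrow> weight {1..h} a x = weight {1..h} a y"
  by (simp add: equiv_representations_def weight_def fun_eq_iff)

lemma representation_function_eq_1_iff:
  "representation_function h a A n = 1 \<longleftrightarrow>
     representations h a A n \<noteq> {} \<and>
     (\<forall>x\<in>representations h a A n. \<forall>y\<in>representations h a A n.
       weight {1..h} a x = weight {1..h} a y)"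
proof -
  let ?R = "representations h a A n" and ?r = "representation_rel h a A n"
  have "representation_function h a A n = 1 \<longleftrightarrow> card (?R // ?r) = 1"
    by (auto simp: representation_function_def Let_def one_enat_def card_ge_0_finite)
  also have "\<dots> \<longleftrightarrow> ?R \<noteq> {} \<and> ?R \<times> ?R \<subseteq> ?r"
    by (rule card_quotient_eq_1_iff[OF equiv_representation_rel])
  finally show ?thesis
    by (auto simp: representation_rel_def equiv_representations_iff_weight_eq)
qed

lemma representationsD:
  assumes "x \<in> representations h a A n"
  shows "x \<in> {1..h} \<rightarrow> A" "(\<Sum>i\<in>{1..h}. a i * x i) = n"
  using assms unfolding representations_def by auto

lemma restrict_mem_representations:
  assumes "x \<in> {1..h} \<rightarrow> A" "(\<Sum>i\<in>{1..h}. a i * x i) = n"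
  shows "restrict x {1..h} \<in> representations h a A n"
  using assms unfolding representations_def by simp

lemma representations_nonempty_iff:
  "representations h a A n \<noteq> {} \<longleftrightarrow> n \<in> value_set {1..h} a A"
proof
  assume "representations h a A n \<noteq> {}"
  then obtain x where "x \<in> representations h a A n" by blast
  from representationsD[OF this] show "n \<in> value_set {1..h} a A"
    by (rule value_setI)
next
  assume "n \<in> value_set {1..h} a A"
  then obtain x where "x \<in> {1..h} \<rightarrow> A" "(\<Sum>i\<in>{1..h}. a i * x i) = n"
    by (rule value_setE)
  from restrict_mem_representations[OF this] show "representations h a A n \<noteq> {}"
    by blast
qed

lemma sidon_set_iff_representations:
  "sidon_set {1..h} a A \<longleftrightarrow> (\<forall>n. \<forall>x\<in>representations h a A n. \<forall>y\<in>representations h a A n.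
     weight {1..h} a x = weight {1..h} a y)"
proof (intro iffI allI ballI)
  fix n x y
  assume sidon: "sidon_set {1..h} a A"
    and x: "x \<in> representations h a A n" and y: "y \<in> representations h a A n"
  have "(\<Sum>i\<in>{1..h}. a i * x i) = (\<Sum>i\<in>{1..h}. a i * y i)"
    unfolding representationsD(2)[OF x] representationsD(2)[OF y] ..
  with sidon representationsD(1)[OF x] representationsD(1)[OF y]
  show "weight {1..h} a x = weight {1..h} a y" by (rule sidon_setD)
next
  assume unique: "\<forall>n. \<forall>x\<in>representations h a A n. \<forall>y\<in>representations h a A n.
    weight {1..h} a x = weight {1..h} a y"
  show "sidon_set {1..h} a A"
  proof (rule sidon_setI)
    fix x y assume "x \<in> {1..h} \<rightarrow> A" "y \<in> {1..h} \<rightarrow> A"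
      and "(\<Sum>i\<in>{1..h}. a i * x i) = (\<Sum>i\<in>{1..h}. a i * y i)"
    then have "weight {1..h} a (restrict x {1..h}) = weight {1..h} a (restrict y {1..h})"
      using unique restrict_mem_representations by blast
    then show "weight {1..h} a x = weight {1..h} a y" by simp
  qed
qed

lemma unique_representation_basis_iff:
  "unique_representation_basis h a A \<longleftrightarrow> value_set {1..h} a A = UNIV \<and> sidon_set {1..h} a A"
  unfolding unique_representation_basis_def representation_function_eq_1_iff
    representations_nonempty_iff sidon_set_iff_representations by blast

section \<open>Formal relations between tuples\<close>

text \<open>Tuples \<open>P, Q\<close> with entries in \<open>I <+> A\<close> are formal tuples over the enlarged set: \<open>Inl i\<close> stands
  for the \<open>i\<close>-th entry of the solution to be adjoined. They differ by \<open>c\<close> times the equation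
  \<open>(\<Sum>i\<in>I. a i * Inl i) = n\<close>.\<close>

definition differ_by_multiple ::
    "'i set \<Rightarrow> ('i \<Rightarrow> int) \<Rightarrow> int set \<Rightarrow> int \<Rightarrow> ('i \<Rightarrow> 'i + int) \<Rightarrow> ('i \<Rightarrow> 'i + int) \<Rightarrow> int \<Rightarrow> bool" where
  "differ_by_multiple I a A n P Q c \<longleftrightarrow>
     (\<forall>i\<in>I. weight_diff I a P Q (Inl i) = c * a i) \<and>
     (\<Sum>b\<in>A. weight_diff I a P Q (Inr b) * b) = - c * n"

lemma differ_by_multiple_swap:
  "differ_by_multiple I a A n P Q c \<Longrightarrow> differ_by_multiple I a A n Q P (- c)"
  by (simp add: differ_by_multiple_def weight_diff_swap[of I a Q P] sum_negf)

lemma sum_weight_diff_Plus: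
  fixes a :: "'i \<Rightarrow> 'c::ring"
  assumes "finite I" "finite A" "P \<in> I \<rightarrow> I <+> A" "Q \<in> I \<rightarrow> I <+> A"
  shows "(\<Sum>i\<in>I. weight_diff I a P Q (Inl i) * g (Inl i)) +
      (\<Sum>b\<in>A. weight_diff I a P Q (Inr b) * g (Inr b)) =
    (\<Sum>i\<in>I. a i * g (P i)) - (\<Sum>i\<in>I. a i * g (Q i))"
  using sum_weight_diff[OF assms(1) _ assms(3,4), of a g] assms(1,2) by (simp add: sum.Plus)

lemma differ_by_multiple_sum:
  assumes "finite I" "finite A" "P \<in> I \<rightarrow> I <+> A" "Q \<in> I \<rightarrow> I <+> A"
    and "differ_by_multiple I a A n P Q c" and "\<And>b. b \<in> A \<Longrightarrow> \<phi> (Inr b) = b"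
  shows "(\<Sum>i\<in>I. a i * \<phi> (P i)) - (\<Sum>i\<in>I. a i * \<phi> (Q i)) = c * ((\<Sum>i\<in>I. a i * \<phi> (Inl i)) - n)"
  using sum_weight_diff_Plus[OF assms(1-4), of a \<phi>] assms(5,6)
  by (simp add: differ_by_multiple_def sum_distrib_left algebra_simps)

lemma weight_eq_if_differ_by_0:
  assumes fin: "finite I" "finite A" and PQ: "P \<in> I \<rightarrow> I <+> A" "Q \<in> I \<rightarrow> I <+> A"
    and diff: "differ_by_multiple I a A n P Q 0" and "A \<noteq> {}" and sidon: "sidon_set I a A"
  shows "weight I a P = weight I a Q"
proof -
  obtain b0 where b0: "b0 \<in> A" using \<open>A \<noteq> {}\<close> by blast
  define \<phi> where "\<phi> = case_sum (\<lambda>_::'a. b0) id"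
  have Inl: "weight_diff I a P Q (Inl i) = 0" if "i \<in> I" for i
    using diff that by (simp add: differ_by_multiple_def)
  have "\<phi> \<circ> P \<in> I \<rightarrow> A" "\<phi> \<circ> Q \<in> I \<rightarrow> A"
    using PQ b0 by (auto simp: \<phi>_def dest!: funcset_mem)
  moreover have "(\<Sum>i\<in>I. a i * (\<phi> \<circ> P) i) = (\<Sum>i\<in>I. a i * (\<phi> \<circ> Q) i)"
    using differ_by_multiple_sum[OF fin PQ diff, of \<phi>] by (simp add: \<phi>_def)
  ultimately have eq: "weight I a (\<phi> \<circ> P) = weight I a (\<phi> \<circ> Q)"
    by (rule sidon_setD[OF sidon])
  have Inr: "weight_diff I a P Q (Inr b) = 0" if "b \<in> A" for b
  proof -
    have "0 = weight_diff I a (\<phi> \<circ> P) (\<phi> \<circ> Q) b"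
      by (simp add: weight_diff_def eq)
    also have "\<dots> = (\<Sum>s\<in>I <+> A. weight_diff I a P Q s * of_bool (\<phi> s = b))"
      using fin PQ by (intro weight_diff_comp) auto
    also have "\<dots> = (\<Sum>b'\<in>A. weight_diff I a P Q (Inr b') * of_bool (b' = b))"
      using fin Inl by (simp add: sum.Plus \<phi>_def del: sum_mult_of_bool_eq)
    also have "\<dots> = weight_diff I a P Q (Inr b)"
      using fin that by simp
    finally show ?thesis ..
  qed
  show ?thesis
    using PQ by (rule weight_diff_eq_0_imp_weight_eq) (use Inl Inr in auto)
qed

definition orbit_step :: "('i \<Rightarrow> 'i + 'b) \<Rightarrow> 'i + 'b \<Rightarrow> 'i + 'b \<Rightarrow> bool" where
  "orbit_step P s t \<longleftrightarrow> (\<exists>i. s = Inl i \<and> t = P i)"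

definition orbit_ends_in :: "('i \<Rightarrow> 'i + 'b) \<Rightarrow> 'i + 'b \<Rightarrow> 'b \<Rightarrow> bool" where
  "orbit_ends_in P s b \<longleftrightarrow> (orbit_step P)\<^sup>*\<^sup>* s (Inr b)"

lemma orbit_ends_in_Inl: "orbit_ends_in P (Inl i) = orbit_ends_in P (P i)"
  unfolding orbit_ends_in_def fun_eq_iff
  by (auto simp: orbit_step_def elim: converse_rtranclpE intro: converse_rtranclp_into_rtranclp)

lemma orbit_ends_in_Inr: "orbit_ends_in P (Inr b) = (\<lambda>b'. b' = b)"
  unfolding orbit_ends_in_def fun_eq_iff
  by (auto simp: orbit_step_def elim: converse_rtranclpE)

lemma orbit_ends_in_mem:
  assumes P: "P \<in> I \<rightarrow> I <+> A" and "orbit_ends_in P s b" "s \<in> I <+> A"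
  shows "b \<in> A"
proof -
  have "t \<in> I <+> A" if "(orbit_step P)\<^sup>*\<^sup>* s t" for t
    using that \<open>s \<in> I <+> A\<close>
  proof induction
    case (step t t')
    then show ?case using P by (auto simp: orbit_step_def)
  qed
  then show ?thesis
    using assms(2) by (auto simp: orbit_ends_in_def)
qed

lemma obtain_orbit_invariant_retraction:
  fixes P :: "'i \<Rightarrow> 'i + 'b"
  assumes P: "P \<in> I \<rightarrow> I <+> A" and "A \<noteq> {}"
  obtains \<phi> where "\<And>b. b \<in> A \<Longrightarrow> \<phi> (Inr b) = b" "\<phi> \<in> I <+> A \<rightarrow> A"
    and "\<And>i. i \<in> I \<Longrightarrow> \<phi> (P i) = \<phi> (Inl i)"
proof -
  obtain b0 where b0: "b0 \<in> A" using \<open>A \<noteq> {}\<close> by blast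
  \<comment> \<open>Indices whose orbit stays in \<open>I\<close> forever may be sent anywhere.\<close>
  define \<phi> where "\<phi> s = (if \<exists>b. orbit_ends_in P s b then SOME b. orbit_ends_in P s b else b0)" for s
  show thesis
  proof
    show "\<phi> (Inr b) = b" for b by (simp add: \<phi>_def orbit_ends_in_Inr)
    show "\<phi> (P i) = \<phi> (Inl i)" for i by (simp add: \<phi>_def orbit_ends_in_Inl)
    show "\<phi> \<in> I <+> A \<rightarrow> A"
    proof
      fix s assume "s \<in> I <+> A"
      then show "\<phi> s \<in> A"
        using b0 orbit_ends_in_mem[OF P] by (auto simp: \<phi>_def intro: someI2)
    qed
  qed
qed

lemma mem_value_set_if_differ_by_1:
  assumes "finite I" "finite A" "P \<in> I \<rightarrow> I <+> A" "Q \<in> I \<rightarrow> I <+> A"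
    and "differ_by_multiple I a A n P Q 1" and "A \<noteq> {}"
  shows "n \<in> value_set I a A"
proof -
  obtain \<phi> where \<phi>: "\<And>b. b \<in> A \<Longrightarrow> \<phi> (Inr b) = b" "\<phi> \<in> I <+> A \<rightarrow> A"
    "\<And>i. i \<in> I \<Longrightarrow> \<phi> (P i) = \<phi> (Inl i)"
    using obtain_orbit_invariant_retraction[OF assms(3,6)] by blast
  have "(\<Sum>i\<in>I. a i * \<phi> (Q i)) = n"
    using differ_by_multiple_sum[OF assms(1-5) \<phi>(1)] \<phi>(3) by simp
  moreover have "(\<lambda>i. \<phi> (Q i)) \<in> I \<rightarrow> A"
    using \<phi>(2) assms(4) by blast
  ultimately show ?thesis by (intro value_setI)
qed

lemma mem_value_set_if_differ_by_ge_2: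
  assumes fin: "finite I" "finite A" and PQ: "P \<in> I \<rightarrow> I <+> A" "Q \<in> I \<rightarrow> I <+> A"
    and diff: "differ_by_multiple I a A n P Q c" and "c \<ge> 2" and "A \<noteq> {}"
  shows "n \<in> value_set I a A"
proof -
  let ?w = "weight_diff I a P Q"
  have Inl: "?w (Inl i) = c * a i" if "i \<in> I" for i
    using diff that by (simp add: differ_by_multiple_def)
  have "c * (\<Sum>i\<in>I. \<bar>a i\<bar>) + (\<Sum>b\<in>A. \<bar>?w (Inr b)\<bar>) = (\<Sum>s\<in>I <+> A. \<bar>?w s\<bar>)"
    using fin Inl \<open>c \<ge> 2\<close> by (simp add: sum.Plus abs_mult sum_distrib_left)
  also have "\<dots> \<le> 2 * (\<Sum>i\<in>I. \<bar>a i\<bar>)"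
    using fin PQ by (intro sum_abs_weight_diff_le) auto
  also have "\<dots> \<le> c * (\<Sum>i\<in>I. \<bar>a i\<bar>)"
    using \<open>c \<ge> 2\<close> by (intro mult_right_mono sum_nonneg) auto
  finally have "(\<Sum>b\<in>A. \<bar>?w (Inr b)\<bar>) = 0"
    by (intro antisym sum_nonneg) auto
  then have Inr: "?w (Inr b) = 0" if "b \<in> A" for b
    using fin that by (simp add: sum_nonneg_eq_0_iff)
  then have "n = 0"
    using diff \<open>c \<ge> 2\<close> by (simp add: differ_by_multiple_def)
  moreover have "(\<Sum>i\<in>I. a i) = 0"
    using sum_weight_diff_Plus[OF fin PQ, of a "\<lambda>_. 1"] Inl Inr \<open>c \<ge> 2\<close>
    by (simp add: sum_distrib_left[symmetric])
  moreover obtain b where "b \<in> A" using \<open>A \<noteq> {}\<close> by blast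
  ultimately show ?thesis
    by (intro value_setI[of "\<lambda>_. b"]) (auto simp: sum_distrib_right[symmetric])
qed

lemma weight_eq_if_differ_by_multiple:
  assumes fin: "finite I" "finite A" and PQ: "P \<in> I \<rightarrow> I <+> A" "Q \<in> I \<rightarrow> I <+> A"
    and diff: "differ_by_multiple I a A n P Q c"
    and A: "A \<noteq> {}" "sidon_set I a A" "n \<notin> value_set I a A"
  shows "weight I a P = weight I a Q"
proof -
  have "c' = 0" if "P' \<in> I \<rightarrow> I <+> A" "Q' \<in> I \<rightarrow> I <+> A"
    and "differ_by_multiple I a A n P' Q' c'" "c' \<ge> 0" for P' Q' c'
  proof -
    consider "c' = 0" | "c' = 1" | "c' \<ge> 2" using \<open>c' \<ge> 0\<close> by linarith
    then show ?thesis
      using A mem_value_set_if_differ_by_1[OF fin that(1,2)]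
        mem_value_set_if_differ_by_ge_2[OF fin that(1-3)] that(3) by cases auto
  qed
  from this[OF PQ diff] this[OF PQ(2,1) differ_by_multiple_swap[OF diff]] have "c = 0"
    by linarith
  with diff A show ?thesis
    using weight_eq_if_differ_by_0[OF fin PQ] by blast
qed

section \<open>Greedy construction\<close>

lemma exists_differ_by_multiple:
  assumes fin: "finite I" "finite A" and PQ: "P \<in> I \<rightarrow> I <+> A" "Q \<in> I \<rightarrow> I <+> A"
    and x: "generic_solution I a n (2 * (\<Sum>i\<in>I. \<bar>a i\<bar>) * ((\<Sum>b\<in>A. \<bar>b\<bar>) + 1)) x"
    and eq: "(\<Sum>i\<in>I. a i * case_sum x id (P i)) = (\<Sum>i\<in>I. a i * case_sum x id (Q i))"
  shows "\<exists>c. differ_by_multiple I a A n P Q c"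
proof -
  let ?w = "weight_diff I a P Q" and ?M = "2 * (\<Sum>i\<in>I. \<bar>a i\<bar>)" and ?B = "\<Sum>b\<in>A. \<bar>b\<bar>"
  have M: "?M \<le> ?M * (?B + 1)" "?M * ?B \<le> ?M * (?B + 1)"
    by (simp_all add: sum_nonneg distrib_left)
  have w: "\<bar>?w s\<bar> \<le> ?M" if "s \<in> I <+> A" for s
    using member_le_sum[OF that, of "\<lambda>s. \<bar>?w s\<bar>"] sum_abs_weight_diff_le[OF fin(1) _ PQ, of a] fin
    by simp
  have "\<forall>i\<in>I. \<bar>?w (Inl i)\<bar> \<le> ?M * (?B + 1)"
    using order_trans[OF w M(1)] by blast
  moreover have "\<forall>b\<in>A. \<bar>?w (Inr b)\<bar> \<le> ?M"
    using w by blast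
  then have "\<bar>\<Sum>b\<in>A. ?w (Inr b) * b\<bar> \<le> ?M * (?B + 1)"
    by (rule order_trans[OF abs_sum_mult_le M(2)])
  moreover have "(\<Sum>i\<in>I. ?w (Inl i) * x i) + (\<Sum>b\<in>A. ?w (Inr b) * b) = 0"
    using sum_weight_diff_Plus[OF fin PQ, of a "case_sum x id"] eq by simp
  ultimately show ?thesis
    unfolding differ_by_multiple_def by (rule generic_solutionD[OF x])
qed

lemma sidon_set_Un_generic_solution:
  assumes fin: "finite I" "finite A" and A: "A \<noteq> {}" "sidon_set I a A" "n \<notin> value_set I a A"
    and x: "generic_solution I a n (2 * (\<Sum>i\<in>I. \<bar>a i\<bar>) * ((\<Sum>b\<in>A. \<bar>b\<bar>) + 1)) x"
  shows "sidon_set I a (A \<union> x ` I)"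
proof -
  have "sidon_set I a (case_sum x id ` (I <+> A))"
  proof (rule sidon_set_image[OF fin(1)])
    fix P Q assume PQ: "P \<in> I \<rightarrow> I <+> A" "Q \<in> I \<rightarrow> I <+> A"
      and "(\<Sum>i\<in>I. a i * case_sum x id (P i)) = (\<Sum>i\<in>I. a i * case_sum x id (Q i))"
    then obtain c where "differ_by_multiple I a A n P Q c"
      using exists_differ_by_multiple[OF fin PQ x] by blast
    then show "weight I a P = weight I a Q"
      by (rule weight_eq_if_differ_by_multiple[OF fin PQ _ A])
  qed
  moreover have "case_sum x id ` (I <+> A) = A \<union> x ` I"
    by (simp add: Plus_def image_Un image_image Un_commute)
  ultimately show ?thesis by simp
qed

lemma exists_sidon_extension:
  assumes fin: "finite I" "finite A" and A: "A \<noteq> {}" "sidon_set I a A"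
    and generic: "\<And>K. \<exists>x \<in> I \<rightarrow> B. generic_solution I a n K x"
  shows "\<exists>C\<subseteq>B. finite C \<and> sidon_set I a (A \<union> C) \<and> n \<in> value_set I a (A \<union> C)"
proof (cases "n \<in> value_set I a A")
  case True
  then show ?thesis using A by (intro exI[of _ "{}"]) simp
next
  case False
  obtain x where x: "x \<in> I \<rightarrow> B"
    and x_generic: "generic_solution I a n (2 * (\<Sum>i\<in>I. \<bar>a i\<bar>) * ((\<Sum>b\<in>A. \<bar>b\<bar>) + 1)) x"
    using generic by blast
  have "sidon_set I a (A \<union> x ` I)"
    using fin A False x_generic by (rule sidon_set_Un_generic_solution)
  moreover have "n \<in> value_set I a (A \<union> x ` I)"
  proof (rule value_setI)
    show "x \<in> I \<rightarrow> A \<union> x ` I" by blast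
    show "(\<Sum>i\<in>I. a i * x i) = n" using x_generic by (rule generic_solution_sum)
  qed
  ultimately show ?thesis
    using x fin(1) by (intro exI[of _ "x ` I"]) auto
qed

lemma exists_sidon_set_representing_all:
  assumes "finite I" "B \<noteq> {}" and generic: "\<And>n K. \<exists>x \<in> I \<rightarrow> B. generic_solution I a n K x"
  shows "\<exists>A\<subseteq>B. value_set I a A = UNIV \<and> sidon_set I a A"
proof -
  define admissible where "admissible A \<longleftrightarrow> finite A \<and> A \<noteq> {} \<and> A \<subseteq> B \<and> sidon_set I a A" for A
  have extend: "\<exists>A'. admissible A' \<and> A \<subseteq> A' \<and> n \<in> value_set I a A'" if A: "admissible A" for A n
  proof -
    have "\<exists>C\<subseteq>B. finite C \<and> sidon_set I a (A \<union> C) \<and> n \<in> value_set I a (A \<union> C)"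
      using A \<open>finite I\<close> unfolding admissible_def by (intro exists_sidon_extension generic) auto
    then obtain C where "C \<subseteq> B" "finite C" "sidon_set I a (A \<union> C)" "n \<in> value_set I a (A \<union> C)"
      by blast
    with A show ?thesis
      by (intro exI[of _ "A \<union> C"]) (auto simp: admissible_def)
  qed
  obtain b where "b \<in> B" using \<open>B \<noteq> {}\<close> by blast
  then have "admissible {b}" by (simp add: admissible_def sidon_set_singleton)
  then have "\<exists>A. \<forall>m. admissible (A m) \<and>
      (A m \<subseteq> A (Suc m) \<and> int_decode m \<in> value_set I a (A (Suc m)))"
    using extend by (intro dependent_nat_choice) blast+
  then obtain A where A: "\<And>m. admissible (A m)" "\<And>m. A m \<subseteq> A (Suc m)"
    "\<And>m. int_decode m \<in> value_set I a (A (Suc m))" by blast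
  have "n \<in> value_set I a (\<Union>(range A))" for n
    using A(3)[of "int_encode n"] value_set_mono[of "A _" "\<Union>(range A)" I a] by auto
  moreover have "A l \<subseteq> A m \<or> A m \<subseteq> A l" for l m
    using lift_Suc_mono_le[of A, OF A(2)] nat_le_linear by blast
  then have "sidon_set I a (\<Union>(range A))"
    using \<open>finite I\<close> A(1)
    by (intro sidon_set_Union_chain) (auto simp: subset_chain_def admissible_def)
  moreover have "\<Union>(range A) \<subseteq> B" using A(1) by (auto simp: admissible_def)
  ultimately show ?thesis by blast
qed

section \<open>Primitive forms\<close>

lemma primitive_form_iff_bezout:
  "primitive_form h a \<longleftrightarrow> (\<exists>u. (\<Sum>i\<in>{1..h}. a i * u i) = 1)"
proof
  assume "primitive_form h a"
  then show "\<exists>u. (\<Sum>i\<in>{1..h}. a i * u i) = 1"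
    using bezout_Gcd[of "{1..h}" a] by (simp add: primitive_form_def)
next
  assume "\<exists>u. (\<Sum>i\<in>{1..h}. a i * u i) = 1"
  moreover have "Gcd (a ` {1..h}) dvd (\<Sum>i\<in>{1..h}. a i * u i)" for u
    by (intro dvd_sum dvd_mult2 Gcd_dvd) auto
  ultimately have "Gcd (a ` {1..h}) dvd 1" by metis
  then show "primitive_form h a" by (simp add: primitive_form_def)
qed

lemma primitive_form_if_basis:
  assumes "unique_representation_basis h a A"
  shows "primitive_form h a"
proof -
  have "1 \<in> value_set {1..h} a A"
    using assms by (simp add: unique_representation_basis_iff)
  then show ?thesis
    unfolding primitive_form_iff_bezout by (blast elim: value_setE)
qed

lemma exists_basis:
  assumes "primitive_form h a"
  shows "\<exists>A. unique_representation_basis h a A"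
proof -
  obtain u where "(\<Sum>i\<in>{1..h}. a i * u i) = 1"
    using assms unfolding primitive_form_iff_bezout by blast
  then have "\<exists>x \<in> {1..h} \<rightarrow> UNIV. generic_solution {1..h} a n K x" for n K
    using exists_generic_solution[of "{1..h}" a u n K] by auto
  then show ?thesis
    using exists_sidon_set_representing_all[of "{1..h}" UNIV a]
    by (auto simp: unique_representation_basis_iff)
qed

lemma exists_basis_ge:
  assumes "primitive_form h a" "p \<in> {1..h}" "a p > 0" "q \<in> {1..h}" "a q < 0"
  shows "\<exists>A. unique_representation_basis h a A \<and> A \<subseteq> {N..}"
proof -
  obtain u where u: "(\<Sum>i\<in>{1..h}. a i * u i) = 1"
    using assms(1) unfolding primitive_form_iff_bezout by blast
  obtain k where k: "(\<Sum>i\<in>{1..h}. a i * k i) = 0" "\<forall>i\<in>{1..h}. k i \<ge> 1"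
    using exists_positive_kernel_vector[OF _ assms(2-5)] by blast
  have "\<exists>x \<in> {1..h} \<rightarrow> {N..}. generic_solution {1..h} a n K x" for n K
    by (rule exists_generic_solution_ge[OF _ u k]) simp
  then show ?thesis
    using exists_sidon_set_representing_all[of "{1..h}" "{N..}" a]
    by (auto simp: unique_representation_basis_iff)
qed

lemma both_signs_if_nonneg_basis:
  assumes "unique_representation_basis h a A" "A \<subseteq> {0..}"
  shows "(\<exists>p\<in>{1..h}. a p > 0) \<and> (\<exists>q\<in>{1..h}. a q < 0)"
proof
  have "1 \<in> value_set {1..h} a A"
    using assms(1) by (simp add: unique_representation_basis_iff)
  then show "\<exists>p\<in>{1..h}. a p > 0"
    using assms(2) by (rule exists_pos_coeff_if_pos_value) simp
  have "- 1 \<in> value_set {1..h} a A"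
    using assms(1) by (simp add: unique_representation_basis_iff)
  then show "\<exists>q\<in>{1..h}. a q < 0"
    using assms(2) by (rule exists_neg_coeff_if_neg_value) simp
qed

lemma not_all_sgn_eq_iff_both_signs:
  fixes a :: "'i \<Rightarrow> 'c::linordered_idom"
  assumes "\<forall>i\<in>I. a i \<noteq> 0"
  shows "\<not> (\<forall>i\<in>I. \<forall>j\<in>I. sgn (a i) = sgn (a j)) \<longleftrightarrow> (\<exists>p\<in>I. a p > 0) \<and> (\<exists>q\<in>I. a q < 0)"
proof
  assume "\<not> (\<forall>i\<in>I. \<forall>j\<in>I. sgn (a i) = sgn (a j))"
  then obtain i j where "i \<in> I" "j \<in> I" "sgn (a i) \<noteq> sgn (a j)" by blast
  then show "(\<exists>p\<in>I. a p > 0) \<and> (\<exists>q\<in>I. a q < 0)"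
    using assms by (metis linorder_neqE_linordered_idom sgn_neg sgn_pos)
next
  assume "(\<exists>p\<in>I. a p > 0) \<and> (\<exists>q\<in>I. a q < 0)"
  then obtain p q where "p \<in> I" "q \<in> I" "sgn (a p) = 1" "sgn (a q) = - 1"
    by auto
  then show "\<not> (\<forall>i\<in>I. \<forall>j\<in>I. sgn (a i) = sgn (a j))"
    by (metis one_neq_neg_one)
qed

theorem theorem2p1:
  fixes h :: nat and a :: "nat \<Rightarrow> int"
  assumes "h \<ge> 1"
    and "\<forall>i\<in>{1..h}. a i \<noteq> 0"
  shows "((\<exists>A. unique_representation_basis h a A) \<longleftrightarrow> primitive_form h a) \<and>
    ((primitive_form h a \<and> \<not> (\<forall>i\<in>{1..h}. \<forall>j\<in>{1..h}. sgn (a i) = sgn (a j))) \<longleftrightarrow>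
     (\<forall>n. \<exists>A. unique_representation_basis h a A \<and> A \<subseteq> {n..}))"
proof (rule conjI)
  show "(\<exists>A. unique_representation_basis h a A) \<longleftrightarrow> primitive_form h a"
    using primitive_form_if_basis exists_basis by blast
  have "primitive_form h a \<and> (\<exists>p\<in>{1..h}. a p > 0) \<and> (\<exists>q\<in>{1..h}. a q < 0) \<longleftrightarrow>
      (\<forall>n. \<exists>A. unique_representation_basis h a A \<and> A \<subseteq> {n..})"
    using exists_basis_ge primitive_form_if_basis both_signs_if_nonneg_basis by blast
  then show "(primitive_form h a \<and> \<not> (\<forall>i\<in>{1..h}. \<forall>j\<in>{1..h}. sgn (a i) = sgn (a j))) \<longleftrightarrow>
      (\<forall>n. \<exists>A. unique_representation_basis h a A \<and> A \<subseteq> {n..})"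
    unfolding not_all_sgn_eq_iff_both_signs[OF assms(2)] .
qed

end
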